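(* Let $d\ge2$ be an integer, $0\le\eta\le1$, and let $$\rho=\frac{d-1+\eta}{d-1}\,\frac{\mathbb{I}}{d^2}-\frac{\eta}{d-1}\,\frac{V}{d}$$ be the Werner state on $\mathbb{C}^d\otimes\mathbb{C}^d$, where $V$ is the flip operator, $V|ij\rangle=|ji\rangle$. If $\rho$ admits a local hidden state model, i.e. if $\eta\le1-\frac1d$, then its conditional Rényi 2-entropy is non-negative: $S_2(A|B)_\rho\ge0$.
   Context: The first tensor factor is system $A$ and the second is system $B$; $\mathbb{I}$ is the identity on $\mathbb{C}^d\otimes\mathbb{C}^d$. The condition $\eta\le1-\frac1d$ is the known condition (Wiseman, Jones, Doherty, 2007) under which the Werner state admits a local hidden state (LHS) model; it is to be taken as the hypothesis of the claim. Rényi 2-entropy: $S_2(\rho)=-\log\mathrm{Tr}(\rho^2)$ (logarithm to base 2). Conditional Rényi 2-entropy: $S_2(A|B)_\rho=S_2(\rho)-S_2(\rho_B)$, where $\rho_B=\mathrm{Tr}_A\rho$. *)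

theory Defs
  imports "HOL-Analysis.Analysis"
begin

text \<open>
  \<open>\<complex>\<^sup>d\<close> is \<open>complex ^ 'n\<close> with \<open>d = CARD('n)\<close>, and operators on \<open>\<complex>\<^sup>d \<otimes> \<complex>\<^sup>d\<close> are matrices in the
  product basis: the index \<open>(i, j)\<close> stands for \<open>|ij\<rangle>\<close>, with \<open>i\<close> belonging to system A and \<open>j\<close> to
  system B.
\<close>

definition flip_op :: "complex ^ ('n::finite \<times> 'n) ^ ('n \<times> 'n)" where
  "flip_op = (\<chi> p q. if p = prod.swap q then 1 else 0)"

lemma flip_op_basis: "flip_op *v axis (i, j) 1 = axis (j, i) 1"
  by (auto simp: flip_op_def matrix_vector_mult_def axis_def vec_eq_iff
        if_distrib[of "\<lambda>x. _ * x"] cong: if_cong)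

definition ptrace_A :: "complex ^ ('a::finite \<times> 'b::finite) ^ ('a \<times> 'b) \<Rightarrow> complex ^ 'b ^ 'b" where
  "ptrace_A \<rho> = (\<chi> j k. \<Sum>i\<in>UNIV. \<rho> $ (i, j) $ (i, k))"

text \<open>For Hermitian \<open>\<rho>\<close> the trace of \<open>\<rho>\<^sup>2\<close> is real, so taking its real part loses nothing.\<close>

definition renyi2_entropy :: "complex ^ 'n::finite ^ 'n \<Rightarrow> real" where
  "renyi2_entropy \<rho> = - log 2 (Re (trace (\<rho> ** \<rho>)))"

definition cond_renyi2_entropy :: "complex ^ ('a::finite \<times> 'b::finite) ^ ('a \<times> 'b) \<Rightarrow> real" where
  "cond_renyi2_entropy \<rho> = renyi2_entropy \<rho> - renyi2_entropy (ptrace_A \<rho>)"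

definition werner_state :: "real \<Rightarrow> complex ^ ('n::finite \<times> 'n) ^ ('n \<times> 'n)" where
  "werner_state \<eta> =
     (let d = real CARD('n) in
       ((d - 1 + \<eta>) / (d - 1)) *\<^sub>R ((1 / d\<^sup>2) *\<^sub>R mat 1)
       - (\<eta> / (d - 1)) *\<^sub>R ((1 / d) *\<^sub>R flip_op))"

end

theory Submission
  imports Defs
begin

text \<open>The claim compares purities: \<rho> must be at most as pure as its reduced state
  \<rho>_B. Write \<rho> = aI - bV. Both purities follow from V^2 = I, tr V = d and tr_A V = I
  (\<open>trace_square_mat_minus_flip_op\<close>, \<open>ptrace_A_mat_minus_flip_op\<close>).
  Normalisation gives ad - b = 1/d, so \<rho>_B = I/d has purity 1/d, while tr(\<rho>^2) = 1/d^2 +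
  b^2(d^2 - 1). The LHS bound on \<eta> says precisely that b \<le> 1/d^2, hence tr(\<rho>^2) \<le>
  2/d^2 \<le> 1/d because d \<ge> 2.\<close>

lemma trace_scaleR:
  fixes A :: "'a::real_algebra_1 ^ 'n::finite ^ 'n"
  shows "trace (c *\<^sub>R A) = c *\<^sub>R trace A"
  by (simp add: trace_def scaleR_sum_right)

lemma matrix_diff_ldistrib:
  fixes A :: "'a::ring_1 ^ 'n::finite ^ 'm"
  shows "A ** (B - C) = A ** B - A ** C"
  by (simp add: matrix_matrix_mult_def vec_eq_iff right_diff_distrib sum_subtractf)

lemma matrix_diff_rdistrib:
  fixes A :: "'a::ring_1 ^ 'n::finite ^ 'm"
  shows "(A - B) ** C = A ** C - B ** C"
  by (simp add: matrix_matrix_mult_def vec_eq_iff left_diff_distrib sum_subtractf)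

lemma flip_op_square: "flip_op ** flip_op = (mat 1 :: complex ^ ('n::finite \<times> 'n) ^ ('n \<times> 'n))"
proof -
  have "(flip_op ** flip_op) $ p $ q = (mat 1 :: complex ^ ('n \<times> 'n) ^ ('n \<times> 'n)) $ p $ q" for p q
  proof -
    have "(flip_op ** flip_op :: complex ^ ('n \<times> 'n) ^ ('n \<times> 'n)) $ p $ q
        = (\<Sum>r\<in>UNIV. if r = prod.swap q then if p = prod.swap r then 1 else 0 else 0)"
      unfolding matrix_matrix_mult_def flip_op_def vec_lambda_beta by (intro sum.cong) simp_all
    also have "\<dots> = (if p = q then 1 else 0)"
      by (subst sum.delta) simp_all
    finally show ?thesis by (simp add: mat_def)
  qed
  then show ?thesis unfolding vec_eq_iff by blast
qed

text \<open>The flip permutes the product basis, so its trace counts the fixed basis vectors, which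
  are the d diagonal ones |ii>.\<close>

lemma trace_flip_op:
  "trace (flip_op :: complex ^ ('n::finite \<times> 'n) ^ ('n \<times> 'n)) = of_nat CARD('n)"
proof -
  define D where "D = range (\<lambda>i::'n. (i, i))"
  have D: "p = prod.swap p \<longleftrightarrow> p \<in> D" for p
    unfolding D_def by (cases p) (force simp only: swap_simp prod.inject image_iff UNIV_I)
  have "trace (flip_op :: complex ^ ('n \<times> 'n) ^ ('n \<times> 'n))
      = (\<Sum>p\<in>UNIV. if p \<in> D then 1 else 0)"
    unfolding trace_def flip_op_def vec_lambda_beta D ..
  also have "\<dots> = of_nat (card D)"
    by (simp add: sum.If_cases)
  also have "card D = CARD('n)"
    unfolding D_def by (intro card_image injI) (simp only: prod.inject)
  finally show ?thesis .
qed

text \<open>Tracing out A turns the identity into d times the identity on B. It turns the flip into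
  the identity, since only i = j = k contributes to the sum over i.\<close>

lemma ptrace_A_mat_minus_flip_op:
  fixes a b :: real
  shows "ptrace_A (a *\<^sub>R mat 1 - b *\<^sub>R flip_op :: complex ^ ('n::finite \<times> 'n) ^ ('n \<times> 'n))
    = (a * real CARD('n) - b) *\<^sub>R mat 1" (is "?L = ?R")
proof -
  have "?L $ j $ k = ?R $ j $ k" for j k
  proof -
    have "?L $ j $ k = (\<Sum>i\<in>UNIV. (if j = k then of_real a else 0)
        - (if i = k then if j = k then of_real b else 0 else 0))"
      unfolding ptrace_A_def vec_lambda_beta by (intro sum.cong)
        (auto simp: flip_op_def mat_def scaleR_conv_of_real[of _ "z :: complex" for z])
    also have "\<dots> = ?R $ j $ k"
      by (simp add: sum_subtractf mat_def scaleR_conv_of_real[of _ "z :: complex" for z])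
    finally show ?thesis .
  qed
  then show ?thesis unfolding vec_eq_iff by blast
qed

text \<open>As the flip squares to the identity, the square of \<rho> stays in the span of the
  identity and the flip, whose traces are d^2 and d.\<close>

lemma trace_square_mat_minus_flip_op:
  fixes a b :: real
  defines "\<rho> \<equiv> a *\<^sub>R mat 1 - b *\<^sub>R flip_op :: complex ^ ('n::finite \<times> 'n) ^ ('n \<times> 'n)"
  shows "trace (\<rho> ** \<rho>)
    = of_real ((a\<^sup>2 + b\<^sup>2) * (real CARD('n))\<^sup>2 - 2 * a * b * real CARD('n))"
proof -
  have "\<rho> ** \<rho> = (a\<^sup>2 + b\<^sup>2) *\<^sub>R mat 1 - (2 * a * b) *\<^sub>R flip_op"
    by (simp add: \<rho>_def matrix_diff_ldistrib matrix_diff_rdistrib matrix_scalar_ac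
        scalar_matrix_assoc[symmetric] flip_op_square power2_eq_square algebra_simps
        scaleR_2[symmetric])
  then show ?thesis
    by (simp add: trace_sub trace_scaleR trace_I trace_flip_op power2_eq_square
        scaleR_conv_of_real[of _ "z :: complex" for z])
qed

theorem mainTheorem8:
  fixes \<eta> :: real
  assumes "CARD('n::finite) \<ge> 2"
    and "0 \<le> \<eta>" and "\<eta> \<le> 1"
    and "\<eta> \<le> 1 - 1 / real CARD('n)"
  shows "cond_renyi2_entropy
           (werner_state \<eta> :: complex ^ ('n \<times> 'n) ^ ('n \<times> 'n)) \<ge> 0"
proof -
  define d where "d = real CARD('n)"
  define b where "b = \<eta> / ((d - 1) * d)"
  \<comment> \<open>Solving ad - b = 1/d for a; this agrees with the coefficient of the identity in
    \<open>werner_state\<close>.\<close>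
  define a where "a = (1 / d + b) / d"
  define P where "P = 1 / d\<^sup>2 + b\<^sup>2 * (d\<^sup>2 - 1)"
  have d: "d \<ge> 2" using assms(1) by (simp add: d_def)
  have \<rho>: "werner_state \<eta> = (a *\<^sub>R mat 1 - b *\<^sub>R flip_op :: complex ^ ('n \<times> 'n) ^ ('n \<times> 'n))"
  proof -
    have "(d - 1 + \<eta>) / (d - 1) * (1 / d\<^sup>2) = a"
      using d by (simp add: a_def b_def field_simps power2_eq_square)
    moreover have "\<eta> / (d - 1) * (1 / d) = b"
      by (simp add: b_def)
    ultimately show ?thesis
      by (simp add: werner_state_def d_def[symmetric])
  qed
  have ad: "a * d - b = 1 / d" using d by (simp add: a_def)
  \<comment> \<open>Isolating ad - b, whose value is known, leaves b as the only quantity to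
    estimate.\<close>
  have "(a\<^sup>2 + b\<^sup>2) * d\<^sup>2 - 2 * a * b * d = (a * d - b)\<^sup>2 + b\<^sup>2 * (d\<^sup>2 - 1)"
    by (simp add: power2_eq_square algebra_simps)
  then have S_AB: "renyi2_entropy (werner_state \<eta> :: complex ^ ('n \<times> 'n) ^ ('n \<times> 'n)) = - log 2 P"
    by (simp add: \<rho> renyi2_entropy_def trace_square_mat_minus_flip_op d_def[symmetric] ad P_def
        power_one_over)
  have S_B: "renyi2_entropy (ptrace_A (werner_state \<eta> :: complex ^ ('n \<times> 'n) ^ ('n \<times> 'n)))
      = - log 2 (1 / d)"
    using d by (simp add: \<rho> ptrace_A_mat_minus_flip_op renyi2_entropy_def d_def[symmetric] ad
        matrix_scalar_ac scalar_matrix_assoc[symmetric] trace_scaleR trace_I)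
  have "d\<^sup>2 > 1" using d by (simp add: one_less_power)
  \<comment> \<open>Positivity is what lets the final bound on \<open>P\<close> pass through the
    logarithm.\<close>
  then have P_pos: "P > 0" using d by (simp add: P_def add_pos_nonneg)
  have "\<eta> \<le> (d - 1) / d" using assms(4) d by (simp add: d_def[symmetric] field_simps)
  then have "b \<le> ((d - 1) / d) / ((d - 1) * d)"
    using d unfolding b_def by (intro divide_right_mono) auto
  \<comment> \<open>The factor d - 1 cancels: at the LHS threshold b equals 1/d^2.\<close>
  then have "b \<le> 1 / d\<^sup>2" using d by (simp add: power2_eq_square)
  then have "b\<^sup>2 \<le> (1 / d\<^sup>2)\<^sup>2"
    using assms(2) d by (intro power_mono) (auto simp: b_def)
  then have "b\<^sup>2 * (d\<^sup>2 - 1) \<le> (1 / d\<^sup>2)\<^sup>2 * (d\<^sup>2 - 1)"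
    using \<open>d\<^sup>2 > 1\<close> by (intro mult_right_mono) auto
  also have "\<dots> \<le> (1 / d\<^sup>2)\<^sup>2 * d\<^sup>2" by (intro mult_left_mono) auto
  also have "\<dots> = 1 / d\<^sup>2" using d by (simp add: power2_eq_square)
  finally have "P \<le> 2 / d\<^sup>2" by (simp add: P_def)
  \<comment> \<open>This is the inequality 2 \<le> d, with equality for qubits.\<close>
  also have "\<dots> \<le> 1 / d" using d by (simp add: field_simps power2_eq_square)
  finally have "log 2 P \<le> log 2 (1 / d)" using P_pos d by simp
  then show ?thesis by (simp add: cond_renyi2_entropy_def S_AB S_B)
qed

end
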